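(* (Locally perfect maps compose.) Let $X$ be a locally compact locale and let $\underline{Y}$ be a locally compact locale in the topos $\mathrm{Sh}(X)$, with external description the locale map $p:Y\to X$. Then the locale $Y$ is locally compact.
   Context: The category of internal locales in $\mathrm{Sh}(X)$ (the dual of the category of internal frames in $\mathrm{Sh}(X)$) is equivalent to the slice category $\mathbf{Loc}/X$ of locales over $X$. The external description of an internal locale $\underline{Y}$ is the locale map $p:Y\to X$ corresponding to it under this equivalence. A locale is locally compact if its frame of opens is a continuous lattice (equivalently, the locale is exponentiable in the category of locales; equivalently, the exponential $\mathbb{S}^{X}$ exists, where $\mathbb{S}$ is the Sierpiński locale); this notion is interpreted internally in $\mathrm{Sh}(X)$ for $\underline{Y}$. A map $p$ for which $\underline{Y}$ is locally compact in $\mathrm{Sh}(X)$ is called locally perfect. *)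

theory Defs
  imports Main
begin

section \<open>Locales and local compactness\<close>

text \<open>
  A (point-free) locale is given by its frame of opens, so a type of class \<open>frame\<close> presents a locale.
  The library class of complete distributive lattices is not used here: it asserts complete
  distributivity, which fails in most frames.
\<close>

class frame = complete_lattice +
  assumes inf_Sup_le: "inf a (Sup S) \<le> Sup (inf a ` S)"

text \<open>
  A locale map \<open>Y \<rightarrow> X\<close> is a frame homomorphism in the opposite direction, from the opens of \<open>X\<close> to
  the opens of \<open>Y\<close>.
\<close>

definition frame_hom :: "('x::frame \<Rightarrow> 'y::frame) \<Rightarrow> bool" where
  "frame_hom f \<longleftrightarrow>
     f top = top \<and> (\<forall>u v. f (inf u v) = inf (f u) (f v)) \<and> (\<forall>S. f (Sup S) = Sup (f ` S))"

definition directed :: "'a::order set \<Rightarrow> bool" where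
  "directed D \<longleftrightarrow> D \<noteq> {} \<and> (\<forall>s\<in>D. \<forall>t\<in>D. \<exists>u\<in>D. s \<le> u \<and> t \<le> u)"

definition way_below :: "'a::complete_lattice \<Rightarrow> 'a \<Rightarrow> bool"  (infix \<open>\<lless>\<close> 50) where
  "a \<lless> b \<longleftrightarrow> (\<forall>D. directed D \<longrightarrow> b \<le> Sup D \<longrightarrow> (\<exists>d\<in>D. a \<le> d))"

text \<open>
  The elements way below \<open>b\<close> are automatically directed in a complete lattice, so continuity only
  asks that \<open>b\<close> be their join.
\<close>

definition locally_compact :: "'a::frame itself \<Rightarrow> bool" where
  "locally_compact _ \<longleftrightarrow> (\<forall>b::'a. b = Sup {a. a \<lless> b})"


section \<open>Sheaves on a locale and their internal logic\<close>

locale sheaf =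
  fixes sec :: "'x::frame \<Rightarrow> 'a set"
    and res :: "'x \<Rightarrow> 'x \<Rightarrow> 'a \<Rightarrow> 'a"  \<comment> \<open>\<open>res U V\<close> restricts from \<open>U\<close> to \<open>V \<le> U\<close>\<close>
  assumes res_sec: "V \<le> U \<Longrightarrow> s \<in> sec U \<Longrightarrow> res U V s \<in> sec V"
    and res_id: "s \<in> sec U \<Longrightarrow> res U U s = s"
    and res_res: "W \<le> V \<Longrightarrow> V \<le> U \<Longrightarrow> s \<in> sec U \<Longrightarrow> res V W (res U V s) = res U W s"
    and glue: "(\<And>V. V \<in> C \<Longrightarrow> t V \<in> sec V) \<Longrightarrow>
       (\<And>V V'. V \<in> C \<Longrightarrow> V' \<in> C \<Longrightarrow> res V (inf V V') (t V) = res V' (inf V V') (t V')) \<Longrightarrow>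
       \<exists>!s. s \<in> sec (Sup C) \<and> (\<forall>V\<in>C. res (Sup C) V s = t V)"

text \<open>
  The internal language of the topos of sheaves on \<open>'x\<close> is interpreted by Kripke--Joyal forcing.
  A formula is the predicate of the stages that force it.  Its free variables of sort \<open>sec\<close> are
  pairs \<open>(V, s)\<close> of an open and a section over it, and an atomic formula restricts them to
  the stage \<open>W\<close> at which it is evaluated; formulas are only evaluated at stages below the
  extents of their free variables.
\<close>

type_synonym 'x form = "'x \<Rightarrow> bool"

definition fconj :: "'x form \<Rightarrow> 'x form \<Rightarrow> 'x form"  (infixr \<open>\<^bold>\<and>\<close> 35) where
  "(\<phi> \<^bold>\<and> \<psi>) W \<longleftrightarrow> \<phi> W \<and> \<psi> W"

definition fimp :: "'x::frame form \<Rightarrow> 'x form \<Rightarrow> 'x form"  (infixr \<open>\<^bold>\<longrightarrow>\<close> 25) where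
  "(\<phi> \<^bold>\<longrightarrow> \<psi>) W \<longleftrightarrow> (\<forall>V\<le>W. \<phi> V \<longrightarrow> \<psi> V)"

definition valid :: "'x::frame form \<Rightarrow> bool" where
  "valid \<phi> \<longleftrightarrow> \<phi> top"

context sheaf
begin

definition fall :: "('x \<times> 'a \<Rightarrow> 'x form) \<Rightarrow> 'x form"  (binder \<open>\<^bold>\<forall>\<close> 10) where
  "(\<^bold>\<forall>s. \<phi> s) W \<longleftrightarrow> (\<forall>V\<le>W. \<forall>s\<in>sec V. \<phi> (V, s) V)"

definition fex :: "('x \<times> 'a \<Rightarrow> 'x form) \<Rightarrow> 'x form"  (binder \<open>\<^bold>\<exists>\<close> 10) where
  "(\<^bold>\<exists>s. \<phi> s) W \<longleftrightarrow> (\<exists>C. Sup C = W \<and> (\<forall>V\<in>C. \<exists>s\<in>sec V. \<phi> (V, s) V))"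

text \<open>
  The sections over \<open>U\<close> of the power object are the subsheaves of the restriction of the sheaf to
  \<open>U\<close>; the values of \<open>S\<close> at opens not below \<open>U\<close> are irrelevant.
\<close>

definition subsheaf :: "'x \<Rightarrow> ('x \<Rightarrow> 'a set) \<Rightarrow> bool" where
  "subsheaf U S \<longleftrightarrow>
     (\<forall>V\<le>U. S V \<subseteq> sec V) \<and>
     (\<forall>V\<le>U. \<forall>W\<le>V. \<forall>s\<in>S V. res V W s \<in> S W) \<and>
     (\<forall>C. Sup C \<le> U \<longrightarrow> (\<forall>s\<in>sec (Sup C). (\<forall>V\<in>C. res (Sup C) V s \<in> S V) \<longrightarrow> s \<in> S (Sup C)))"

definition fall_pow :: "(('x \<Rightarrow> 'a set) \<Rightarrow> 'x form) \<Rightarrow> 'x form"  (binder \<open>\<^bold>\<forall>\<^sub>P\<close> 10) where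
  "(\<^bold>\<forall>\<^sub>PS. \<phi> S) W \<longleftrightarrow> (\<forall>V\<le>W. \<forall>S. subsheaf V S \<longrightarrow> \<phi> S V)"

definition fmem :: "'x \<times> 'a \<Rightarrow> ('x \<Rightarrow> 'a set) \<Rightarrow> 'x form"  (infix \<open>\<^bold>\<in>\<close> 50) where
  "(s \<^bold>\<in> S) W \<longleftrightarrow> res (fst s) W (snd s) \<in> S W"

end


section \<open>Internal frames\<close>

text \<open>An internal poset: the order is a subsheaf of the product of the sheaf with itself.\<close>

locale internal_poset = sheaf sec res
  for sec :: "'x::frame \<Rightarrow> 'a set" and res :: "'x \<Rightarrow> 'x \<Rightarrow> 'a \<Rightarrow> 'a" +
  fixes le :: "'x \<Rightarrow> 'a \<Rightarrow> 'a \<Rightarrow> bool"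
  assumes le_refl: "s \<in> sec U \<Longrightarrow> le U s s"
    and le_trans: "s \<in> sec U \<Longrightarrow> t \<in> sec U \<Longrightarrow> r \<in> sec U \<Longrightarrow> le U s t \<Longrightarrow> le U t r \<Longrightarrow> le U s r"
    and le_antisym: "s \<in> sec U \<Longrightarrow> t \<in> sec U \<Longrightarrow> le U s t \<Longrightarrow> le U t s \<Longrightarrow> s = t"
    and le_res: "V \<le> U \<Longrightarrow> s \<in> sec U \<Longrightarrow> t \<in> sec U \<Longrightarrow> le U s t \<Longrightarrow> le V (res U V s) (res U V t)"
    and le_local: "s \<in> sec (Sup C) \<Longrightarrow> t \<in> sec (Sup C) \<Longrightarrow>
       (\<And>V. V \<in> C \<Longrightarrow> le V (res (Sup C) V s) (res (Sup C) V t)) \<Longrightarrow> le (Sup C) s t"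
begin

definition fle :: "'x \<times> 'a \<Rightarrow> 'x \<times> 'a \<Rightarrow> 'x form"  (infix \<open>\<^bold>\<le>\<close> 50) where
  "(s \<^bold>\<le> t) W \<longleftrightarrow> le W (res (fst s) W (snd s)) (res (fst t) W (snd t))"

text \<open>\<open>t\<close> is the join of the internal subset \<open>{s. \<phi> s}\<close>.\<close>

definition is_join :: "('x \<times> 'a \<Rightarrow> 'x form) \<Rightarrow> 'x \<times> 'a \<Rightarrow> 'x form" where
  "is_join \<phi> t = ((\<^bold>\<forall>s. \<phi> s \<^bold>\<longrightarrow> s \<^bold>\<le> t) \<^bold>\<and> (\<^bold>\<forall>u. (\<^bold>\<forall>s. \<phi> s \<^bold>\<longrightarrow> s \<^bold>\<le> u) \<^bold>\<longrightarrow> t \<^bold>\<le> u))"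

definition is_meet :: "'x \<times> 'a \<Rightarrow> 'x \<times> 'a \<Rightarrow> 'x \<times> 'a \<Rightarrow> 'x form" where
  "is_meet a b m = (m \<^bold>\<le> a \<^bold>\<and> m \<^bold>\<le> b \<^bold>\<and> (\<^bold>\<forall>w. w \<^bold>\<le> a \<^bold>\<and> w \<^bold>\<le> b \<^bold>\<longrightarrow> w \<^bold>\<le> m))"

definition int_directed :: "('x \<Rightarrow> 'a set) \<Rightarrow> 'x form" where
  "int_directed S = ((\<^bold>\<exists>s. s \<^bold>\<in> S) \<^bold>\<and>
     (\<^bold>\<forall>s. \<^bold>\<forall>t. s \<^bold>\<in> S \<^bold>\<and> t \<^bold>\<in> S \<^bold>\<longrightarrow> (\<^bold>\<exists>u. u \<^bold>\<in> S \<^bold>\<and> s \<^bold>\<le> u \<^bold>\<and> t \<^bold>\<le> u)))"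

definition int_way_below :: "'x \<times> 'a \<Rightarrow> 'x \<times> 'a \<Rightarrow> 'x form" where
  "int_way_below a b = (\<^bold>\<forall>\<^sub>PS. int_directed S \<^bold>\<longrightarrow>
     (\<^bold>\<forall>j. is_join (\<lambda>s. s \<^bold>\<in> S) j \<^bold>\<longrightarrow> b \<^bold>\<le> j) \<^bold>\<longrightarrow> (\<^bold>\<exists>s. s \<^bold>\<in> S \<^bold>\<and> a \<^bold>\<le> s))"

definition int_locally_compact :: bool where
  "int_locally_compact \<longleftrightarrow> valid (\<^bold>\<forall>b. is_join (\<lambda>a. int_way_below a b) b)"

end

locale internal_frame = internal_poset sec res le
  for sec :: "'x::frame \<Rightarrow> 'a set" and res :: "'x \<Rightarrow> 'x \<Rightarrow> 'a \<Rightarrow> 'a"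
    and le :: "'x \<Rightarrow> 'a \<Rightarrow> 'a \<Rightarrow> bool" +
  assumes int_complete: "valid (\<^bold>\<forall>\<^sub>PS. \<^bold>\<exists>j. is_join (\<lambda>s. s \<^bold>\<in> S) j)"
    and int_distrib: "valid (\<^bold>\<forall>a. \<^bold>\<forall>\<^sub>PS. \<^bold>\<forall>j. \<^bold>\<forall>m. is_join (\<lambda>s. s \<^bold>\<in> S) j \<^bold>\<and> is_meet a j m \<^bold>\<longrightarrow>
       is_join (\<lambda>x. \<^bold>\<exists>s. s \<^bold>\<in> S \<^bold>\<and> is_meet a s x) m)"


section \<open>The external description of an internal locale\<close>

definition internal_poset_iso ::
  "('x::frame \<Rightarrow> 'a set) \<Rightarrow> ('x \<Rightarrow> 'x \<Rightarrow> 'a \<Rightarrow> 'a) \<Rightarrow> ('x \<Rightarrow> 'a \<Rightarrow> 'a \<Rightarrow> bool) \<Rightarrow>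
   ('x \<Rightarrow> 'b set) \<Rightarrow> ('x \<Rightarrow> 'x \<Rightarrow> 'b \<Rightarrow> 'b) \<Rightarrow> ('x \<Rightarrow> 'b \<Rightarrow> 'b \<Rightarrow> bool) \<Rightarrow> ('x \<Rightarrow> 'a \<Rightarrow> 'b) \<Rightarrow> bool" where
  "internal_poset_iso sec res le sec' res' le' f \<longleftrightarrow>
     (\<forall>U. bij_betw (f U) (sec U) (sec' U)) \<and>
     (\<forall>U. \<forall>s\<in>sec U. \<forall>t\<in>sec U. le U s t \<longleftrightarrow> le' U (f U s) (f U t)) \<and>
     (\<forall>U. \<forall>V\<le>U. \<forall>s\<in>sec U. f V (res U V s) = res' U V (f U s))"

text \<open>
  On objects, the equivalence between locales over \<open>X\<close> and internal locales in sheaves on \<open>X\<close> sends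
  \<open>p : Y \<rightarrow> X\<close> to the internal frame \<open>p\<^sub>* \<Omega>\<^sub>Y\<close>, where \<open>\<Omega>\<^sub>Y\<close> is the sheaf of opens of \<open>Y\<close>: its sections
  over \<open>U\<close> are the opens of \<open>Y\<close> below \<open>p\<^sup>* U\<close>, and restriction to \<open>V\<close> is meet with \<open>p\<^sup>* V\<close>.  An
  isomorphism of internal posets between internal frames is an isomorphism of internal frames.
\<close>

definition push_sec :: "('x::frame \<Rightarrow> 'y::frame) \<Rightarrow> 'x \<Rightarrow> 'y set" where
  "push_sec p U = {v. v \<le> p U}"

definition push_res :: "('x::frame \<Rightarrow> 'y::frame) \<Rightarrow> 'x \<Rightarrow> 'x \<Rightarrow> 'y \<Rightarrow> 'y" where
  "push_res p U V v = inf v (p V)"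

definition push_le :: "'x::frame \<Rightarrow> 'y::frame \<Rightarrow> 'y \<Rightarrow> bool" where
  "push_le U v w \<longleftrightarrow> v \<le> w"

definition external_description ::
  "('x::frame \<Rightarrow> 'a set) \<Rightarrow> ('x \<Rightarrow> 'x \<Rightarrow> 'a \<Rightarrow> 'a) \<Rightarrow> ('x \<Rightarrow> 'a \<Rightarrow> 'a \<Rightarrow> bool) \<Rightarrow> ('x \<Rightarrow> 'y::frame) \<Rightarrow> bool"
  where
  "external_description sec res le p \<longleftrightarrow>
     frame_hom p \<and> (\<exists>f. internal_poset_iso sec res le (push_sec p) (push_res p) push_le f)"

end

theory Submission
  imports Defs
begin

text \<open>
  Work with the opens of \<open>Y\<close> instead of the sections of the internal frame.  The point is that
  \<open>a \<lless> b\<close> forced at stage \<open>V\<close> and \<open>W \<lless> V\<close> in \<open>X\<close> give \<open>inf a (p W) \<lless> b\<close> in \<open>Y\<close>.  Indeed, a directed set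
  \<open>D\<close> with join above \<open>b\<close> generates an internal ideal, consisting of the opens that are locally below
  a member of \<open>D\<close>.  It is forced to contain \<open>a\<close>, so the directed family of the opens \<open>U\<close>
  of \<open>X\<close> for which \<open>inf a (p U)\<close> is below a member of \<open>D\<close> covers \<open>V\<close>, and hence has a member above \<open>W\<close>.
\<close>

section \<open>Frame homomorphisms and stages of boundedness by a directed set\<close>

lemma inf_Sup_distrib: "inf a (Sup S) = Sup (inf a ` S)" for a :: "'a::frame"
proof (rule antisym[OF inf_Sup_le])
  show "Sup (inf a ` S) \<le> inf a (Sup S)"
    by (rule Sup_least) (auto intro: le_infI2 Sup_upper)
qed

lemma inf_sup_distrib_frame: "inf a (sup b c) = sup (inf a b) (inf a c)" for a :: "'a::frame"
  using inf_Sup_distrib[of a "{b, c}"] by simp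

context
  fixes p :: "'x::frame \<Rightarrow> 'y::frame"
  assumes hom: "frame_hom p"
begin

lemma frame_hom_top: "p top = top"
  using hom by (simp add: frame_hom_def)

lemma frame_hom_inf: "p (inf u v) = inf (p u) (p v)"
  using hom by (simp add: frame_hom_def)

lemma frame_hom_Sup: "p (Sup S) = Sup (p ` S)"
  using hom by (simp add: frame_hom_def)

lemma frame_hom_sup: "p (sup u v) = sup (p u) (p v)"
  using frame_hom_Sup[of "{u, v}"] by simp

lemma frame_hom_bot: "p bot = bot"
  using frame_hom_Sup[of "{}"] by simp

lemma frame_hom_mono: "u \<le> v \<Longrightarrow> p u \<le> p v"
  by (metis frame_hom_inf inf.absorb_iff2 inf.commute)

end

text \<open>The join of this set is the open of \<open>X\<close> that is the truth value of
  "\<open>s\<close> lies below some member of \<open>D\<close>" in the internal logic.\<close>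

definition below_stages :: "('x::frame \<Rightarrow> 'y::frame) \<Rightarrow> 'y set \<Rightarrow> 'y \<Rightarrow> 'x set" where
  "below_stages p D s = {U. \<exists>d\<in>D. inf s (p U) \<le> d}"

text \<open>Since \<open>p\<close> preserves finite joins, \<open>bot\<close> is a stage, and over
  \<open>sup U V\<close> the open \<open>s\<close> splits into its parts over \<open>U\<close> and
  \<open>V\<close>; a common upper bound in \<open>D\<close> of the two bounds then works for both
  parts.\<close>

lemma directed_below_stages:
  assumes hom: "frame_hom p" and D: "directed D"
  shows "directed (below_stages p D s)"
  unfolding directed_def
proof (intro conjI ballI)
  obtain d where "d \<in> D"
    using D by (auto simp: directed_def)
  then have "bot \<in> below_stages p D s"
    by (auto simp: below_stages_def frame_hom_bot[OF hom])
  then show "below_stages p D s \<noteq> {}"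
    by auto
next
  fix U V
  assume "U \<in> below_stages p D s" "V \<in> below_stages p D s"
  then obtain d e where de: "d \<in> D" "e \<in> D" "inf s (p U) \<le> d" "inf s (p V) \<le> e"
    by (auto simp: below_stages_def)
  then obtain c where c: "c \<in> D" "d \<le> c" "e \<le> c"
    using D by (auto simp: directed_def)
  have "inf s (p (sup U V)) \<le> c"
    unfolding frame_hom_sup[OF hom] inf_sup_distrib_frame
    using de c by (meson le_supI order_trans)
  then have "sup U V \<in> below_stages p D s"
    using c by (auto simp: below_stages_def)
  then show "\<exists>W\<in>below_stages p D s. U \<le> W \<and> V \<le> W"
    by (intro bexI[of _ "sup U V"]) auto
qed

lemma below_stages_down:
  assumes "frame_hom p" "U \<in> below_stages p D s" "V \<le> U"
  shows "V \<in> below_stages p D s"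
  using assms unfolding below_stages_def
  by (blast intro: order_trans[OF inf_mono[OF order_refl frame_hom_mono]])

lemma below_stages_antimono: "s \<le> t \<Longrightarrow> below_stages p D t \<subseteq> below_stages p D s"
  by (auto simp: below_stages_def intro: order_trans[OF inf_mono[OF _ order_refl]])

text \<open>Intersecting a stage of the restriction of \<open>s\<close> with \<open>V\<close> gives
  a stage of \<open>s\<close> itself, and these intersections still cover \<open>V\<close>. Covering
  \<open>V\<close> may therefore be tested on the restriction.\<close>

lemma Sup_below_stages_local:
  assumes hom: "frame_hom p" and V: "V \<le> Sup (below_stages p D (inf s (p V)))"
  shows "V \<le> Sup (below_stages p D s)"
proof -
  have "inf V ` below_stages p D (inf s (p V)) \<subseteq> below_stages p D s"
    by (auto simp: below_stages_def frame_hom_inf[OF hom] inf.assoc)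
  moreover have "V \<le> Sup (inf V ` below_stages p D (inf s (p V)))"
    using V by (metis inf_Sup_distrib inf.absorb1 order_refl)
  ultimately show ?thesis
    using Sup_subset_mono order_trans by blast
qed

section \<open>Sections as opens of \<open>Y\<close>, and the internal ideal generated by a directed
  set\<close>

locale described_poset = internal_poset sec res le
  for sec :: "'x::frame \<Rightarrow> 'a set" and res :: "'x \<Rightarrow> 'x \<Rightarrow> 'a \<Rightarrow> 'a"
    and le :: "'x \<Rightarrow> 'a \<Rightarrow> 'a \<Rightarrow> bool" +
  fixes p :: "'x \<Rightarrow> 'y::frame" and f :: "'x \<Rightarrow> 'a \<Rightarrow> 'y"
  assumes hom: "frame_hom p"
    and iso: "internal_poset_iso sec res le (push_sec p) (push_res p) push_le f"
begin

lemma open_le: "s \<in> sec U \<Longrightarrow> f U s \<le> p U"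
  using iso by (fastforce simp: internal_poset_iso_def push_sec_def bij_betw_def)

lemma open_surj:
  assumes "v \<le> p U"
  obtains s where "s \<in> sec U" "f U s = v"
proof -
  have "v \<in> f U ` sec U"
    using iso assms by (auto simp: internal_poset_iso_def push_sec_def bij_betw_def)
  then show ?thesis
    using that by auto
qed

lemma open_res: "V \<le> U \<Longrightarrow> s \<in> sec U \<Longrightarrow> f V (res U V s) = inf (f U s) (p V)"
  using iso by (auto simp: internal_poset_iso_def push_res_def)

lemma fle_iff:
  assumes "W \<le> U" "W \<le> V" "s \<in> sec U" "t \<in> sec V"
  shows "((U, s) \<^bold>\<le> (V, t)) W \<longleftrightarrow> inf (f U s) (p W) \<le> f V t"
proof -
  have "((U, s) \<^bold>\<le> (V, t)) W \<longleftrightarrow> f W (res U W s) \<le> f W (res V W t)"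
    using iso assms by (simp add: fle_def internal_poset_iso_def push_le_def res_sec)
  then show ?thesis
    using assms by (simp add: open_res)
qed

text \<open>Asking for a cover of \<open>U\<close> by stages, instead of one member of
  \<open>D\<close> above \<open>s\<close>, is the sheafification that makes gluing hold.\<close>

definition gen_ideal :: "'y set \<Rightarrow> 'x \<Rightarrow> 'a set" where
  "gen_ideal D U = {s \<in> sec U. U \<le> Sup (below_stages p D (f U s))}"

lemma gen_idealI:
  assumes "s \<in> sec U" "d \<in> D" "f U s \<le> d"
  shows "s \<in> gen_ideal D U"
proof -
  have "U \<in> below_stages p D (f U s)"
    using assms by (auto simp: below_stages_def intro: le_infI1)
  then show ?thesis
    using assms by (simp add: gen_ideal_def Sup_upper)
qed

lemma fmem_gen_ideal: "s \<in> sec U \<Longrightarrow> ((U, s) \<^bold>\<in> gen_ideal D) U \<longleftrightarrow> s \<in> gen_ideal D U"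
  by (simp add: fmem_def res_id)

lemma subsheaf_gen_ideal: "subsheaf U (gen_ideal D)"
  unfolding subsheaf_def
proof (intro conjI allI impI ballI)
  show "gen_ideal D V \<subseteq> sec V" for V
    by (auto simp: gen_ideal_def)
next
  fix V W s
  assume VW: "W \<le> V" and s: "s \<in> gen_ideal D V"
  have "f W (res V W s) \<le> f V s"
    using VW s by (simp add: gen_ideal_def open_res)
  then have "Sup (below_stages p D (f V s)) \<le> Sup (below_stages p D (f W (res V W s)))"
    by (intro Sup_subset_mono below_stages_antimono)
  moreover have "s \<in> sec V" "V \<le> Sup (below_stages p D (f V s))"
    using s by (simp_all add: gen_ideal_def)
  ultimately show "res V W s \<in> gen_ideal D W"
    unfolding gen_ideal_def using VW by (blast intro: res_sec order_trans)
next
  fix C s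
  assume s: "s \<in> sec (Sup C)" and local: "\<forall>V\<in>C. res (Sup C) V s \<in> gen_ideal D V"
  \<comment> \<open>The local hypothesis speaks of the restriction of \<open>s\<close> to
    \<open>V\<close>; locality carries the cover over to \<open>s\<close>.\<close>
  have "V \<le> Sup (below_stages p D (f (Sup C) s))" if "V \<in> C" for V
  proof (rule Sup_below_stages_local[OF hom])
    show "V \<le> Sup (below_stages p D (inf (f (Sup C) s) (p V)))"
      using that local s Sup_upper[OF that] by (auto simp: gen_ideal_def open_res)
  qed
  then show "s \<in> gen_ideal D (Sup C)"
    using s by (auto simp: gen_ideal_def intro: Sup_least)
qed

lemma fexI:
  assumes "s \<in> sec W" "\<phi> (W, s) W"
  shows "(\<^bold>\<exists>s. \<phi> s) W"
  unfolding fex_def using assms by (intro exI[of _ "{W}"]) auto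

lemma int_directed_gen_ideal:
  assumes D: "directed D"
  shows "int_directed (gen_ideal D) U"
  unfolding int_directed_def fconj_def[of "\<^bold>\<exists>s. s \<^bold>\<in> gen_ideal D"]
proof (intro conjI)
  obtain d where d: "d \<in> D"
    using D by (auto simp: directed_def)
  obtain s where "s \<in> sec U" "f U s = inf d (p U)"
    by (rule open_surj[of "inf d (p U)"]) auto
  with d show "(\<^bold>\<exists>s. s \<^bold>\<in> gen_ideal D) U"
    by (intro fexI[where s = s]) (auto simp: fmem_gen_ideal intro: gen_idealI)
next
  have "(\<^bold>\<exists>u. u \<^bold>\<in> gen_ideal D \<^bold>\<and> (V, s) \<^bold>\<le> u \<^bold>\<and> (V', t) \<^bold>\<le> u) W"
    if V: "s \<in> sec V" and V': "t \<in> sec V'" and W: "W \<le> V" "W \<le> V'"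
      and s: "((V, s) \<^bold>\<in> gen_ideal D) W" and t: "((V', t) \<^bold>\<in> gen_ideal D) W" for V V' W s t
  proof -
    \<comment> \<open>An upper bound need only exist locally. The cover \<open>?C\<close> collects
      the stages within \<open>W\<close> where both \<open>s\<close> and \<open>t\<close> lie below
      members of \<open>D\<close>.\<close>
    let ?I = "\<lambda>U s. below_stages p D (f U s)"
    let ?C = "{U. U \<le> W \<and> U \<in> ?I V s \<and> U \<in> ?I V' t}"
    have "W \<le> Sup (below_stages p D (inf (f V s) (p W)))"
      "W \<le> Sup (below_stages p D (inf (f V' t) (p W)))"
      using s t V V' W by (simp_all add: fmem_def gen_ideal_def open_res)
    then have Ws: "W \<le> Sup (?I V s)" and Wt: "W \<le> Sup (?I V' t)"
      using Sup_below_stages_local[OF hom] by auto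
    \<comment> \<open>Stages are closed downwards, so these triple meets lie in \<open>?C\<close>.
      Distributing meets over the two joins then shows that the common refinement of the two covers
      still covers \<open>W\<close>.\<close>
    have "inf (inf W A) B \<in> ?C" if A: "A \<in> ?I V s" and B: "B \<in> ?I V' t" for A B
    proof -
      have "inf (inf W A) B \<le> W" "inf (inf W A) B \<le> A" "inf (inf W A) B \<le> B"
        by (auto intro: le_infI1)
      then show ?thesis
        using below_stages_down[OF hom A] below_stages_down[OF hom B] by blast
    qed
    then have "inf (inf W A) (Sup (?I V' t)) \<le> Sup ?C" if "A \<in> ?I V s" for A
      unfolding inf_Sup_distrib using that by (intro Sup_least) (auto intro!: Sup_upper)
    moreover have "inf (inf W A) (Sup (?I V' t)) = inf W A" for A
      using Wt by (intro inf.absorb1 le_infI1)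
    ultimately have "inf W A \<le> Sup ?C" if "A \<in> ?I V s" for A
      using that by simp
    then have "inf W (Sup (?I V s)) \<le> Sup ?C"
      unfolding inf_Sup_distrib by (intro Sup_least) auto
    then have "W \<le> Sup ?C"
      using Ws by (simp add: inf.absorb1)
    then have "Sup ?C = W"
      by (intro antisym Sup_least) auto
    moreover have "\<exists>u\<in>sec U. ((U, u) \<^bold>\<in> gen_ideal D \<^bold>\<and> (V, s) \<^bold>\<le> (U, u) \<^bold>\<and> (V', t) \<^bold>\<le> (U, u)) U"
      if U: "U \<in> ?C" for U
    \<comment> \<open>The witness over \<open>U\<close> is the restriction to \<open>U\<close> of a
      common upper bound \<open>c\<close> in \<open>D\<close>.\<close>
    proof -
      obtain d e where "d \<in> D" "e \<in> D" "inf (f V s) (p U) \<le> d" "inf (f V' t) (p U) \<le> e"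
        using U by (auto simp: below_stages_def)
      moreover then obtain c where "c \<in> D" "d \<le> c" "e \<le> c"
        using D by (auto simp: directed_def)
      moreover obtain u where "u \<in> sec U" "f U u = inf c (p U)"
        by (rule open_surj[of "inf c (p U)"]) auto
      moreover have "U \<le> V" "U \<le> V'"
        using U W by auto
      ultimately show ?thesis
        using V V'
        unfolding fconj_def
        by (intro bexI[of _ u] conjI)
          (simp_all add: fmem_gen_ideal fle_iff gen_idealI order_trans)
    qed
    ultimately show ?thesis
      unfolding fex_def by blast
  qed
  then show "(\<^bold>\<forall>s. \<^bold>\<forall>t. s \<^bold>\<in> gen_ideal D \<^bold>\<and> t \<^bold>\<in> gen_ideal D \<^bold>\<longrightarrow>
      (\<^bold>\<exists>u. u \<^bold>\<in> gen_ideal D \<^bold>\<and> s \<^bold>\<le> u \<^bold>\<and> t \<^bold>\<le> u)) U"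
    unfolding fall_def fimp_def fconj_def[of "_ \<^bold>\<in> _" "_ \<^bold>\<in> _"] by (meson order_trans)
qed

text \<open>For each \<open>d\<close> in \<open>D\<close> the open \<open>inf (p W) d\<close>
  belongs to the ideal over \<open>W\<close>, so it lies below \<open>j\<close>. By distributivity
  so does \<open>inf (p W) (Sup D)\<close>, which is above the restriction of \<open>b\<close> to
  \<open>W\<close>.\<close>

lemma le_join_gen_ideal:
  assumes b: "b \<in> sec T" and V: "V \<le> T" and D: "f T b \<le> Sup D"
  shows "(\<^bold>\<forall>j. is_join (\<lambda>s. s \<^bold>\<in> gen_ideal D) j \<^bold>\<longrightarrow> (T, b) \<^bold>\<le> j) V"
proof -
  have "((T, b) \<^bold>\<le> (U, j)) W"
    if U: "U \<le> V" "j \<in> sec U" "W \<le> U" and join: "is_join (\<lambda>s. s \<^bold>\<in> gen_ideal D) (U, j) W"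
    for U j W
  proof -
    have "inf (p W) d \<le> f U j" if d: "d \<in> D" for d
    proof -
      obtain s where s: "s \<in> sec W" "f W s = inf (p W) d"
        by (rule open_surj[of "inf (p W) d"]) auto
      then have "((W, s) \<^bold>\<in> gen_ideal D) W"
        using d by (auto simp: fmem_gen_ideal intro: gen_idealI)
      then have "((W, s) \<^bold>\<le> (U, j)) W"
        using join s(1) by (auto simp: is_join_def fconj_def fall_def fimp_def)
      then show ?thesis
        using s U by (simp add: fle_iff inf.absorb1)
    qed
    then have "inf (p W) (Sup D) \<le> f U j"
      unfolding inf_Sup_distrib by (intro Sup_least) auto
    moreover have "inf (f T b) (p W) \<le> inf (p W) (Sup D)"
      using D by (simp add: le_infI1)
    ultimately show ?thesis
      using b U V by (subst fle_iff) (blast intro: order_trans)+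
  qed
  then show ?thesis
    by (auto simp: fall_def fimp_def)
qed

section \<open>From the internal way-below relation to that of \<open>Y\<close>\<close>

lemma way_below_of_int_way_below:
  assumes a: "a \<in> sec U" and b: "b \<in> sec T" and V: "V \<le> U" "V \<le> T"
    and ab: "int_way_below (U, a) (T, b) V" and W: "W \<lless> V"
  shows "inf (f U a) (p W) \<lless> f T b"
  unfolding way_below_def
proof (intro allI impI)
  fix D
  assume D: "directed D" and bD: "f T b \<le> Sup D"
  have "(\<^bold>\<exists>s. s \<^bold>\<in> gen_ideal D \<^bold>\<and> (U, a) \<^bold>\<le> s) V"
    using ab subsheaf_gen_ideal int_directed_gen_ideal[OF D] le_join_gen_ideal[OF b V(2) bD]
    unfolding int_way_below_def fall_pow_def fimp_def[of "int_directed _"]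
      fimp_def[of "fall _"] by blast
  then obtain C where C: "Sup C = V"
    and ex: "\<And>A. A \<in> C \<Longrightarrow> \<exists>s\<in>sec A. ((A, s) \<^bold>\<in> gen_ideal D \<^bold>\<and> (U, a) \<^bold>\<le> (A, s)) A"
    unfolding fex_def by blast
  \<comment> \<open>Over \<open>A\<close> the restriction of \<open>a\<close> lies below an element
    of the ideal and inherits its cover by stages; locality then passes from the restriction to
    \<open>a\<close>.\<close>
  have "A \<le> Sup (below_stages p D (f U a))" if A: "A \<in> C" for A
  proof -
    have "A \<le> U"
      using A C V Sup_upper order_trans by blast
    moreover obtain s where "s \<in> sec A" "((A, s) \<^bold>\<in> gen_ideal D) A" "((U, a) \<^bold>\<le> (A, s)) A"
      using ex[OF A] by (auto simp: fconj_def)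
    ultimately have "inf (f U a) (p A) \<le> f A s" "A \<le> Sup (below_stages p D (f A s))"
      using a by (auto simp: fle_iff fmem_gen_ideal gen_ideal_def)
    then have "A \<le> Sup (below_stages p D (inf (f U a) (p A)))"
      by (meson Sup_subset_mono below_stages_antimono order_trans)
    then show ?thesis
      by (rule Sup_below_stages_local[OF hom])
  qed
  then have "V \<le> Sup (below_stages p D (f U a))"
    using C by (auto intro: Sup_least)
  \<comment> \<open>One stage above \<open>W\<close> is extracted from the directed cover of
    \<open>V\<close>; by downward closure \<open>W\<close> is a stage too, and its bound in
    \<open>D\<close> is the one sought.\<close>
  then obtain A where "A \<in> below_stages p D (f U a)" "W \<le> A"
    using W directed_below_stages[OF hom D] unfolding way_below_def by blast
  then show "\<exists>d\<in>D. inf (f U a) (p W) \<le> d"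
    using below_stages_down[OF hom] unfolding below_stages_def by blast
qed

text \<open>The external join \<open>?u\<close> of the opens way below \<open>y\<close> is shown to
  be an internal upper bound of the elements internally way below \<open>y\<close>. As
  \<open>y\<close> is the least such bound, \<open>y\<close> lies below \<open>?u\<close>.\<close>

lemma locally_compact_described:
  assumes X: "locally_compact TYPE('x)" and Y: "int_locally_compact"
  shows "locally_compact TYPE('y)"
  unfolding locally_compact_def
proof (intro allI antisym)
  fix y :: 'y
  let ?u = "Sup {a. a \<lless> y}"
  show "?u \<le> y"
  proof (rule Sup_least)
    fix a
    assume "a \<in> {a. a \<lless> y}"
    moreover have "directed {y}" "y \<le> Sup {y}"
      by (auto simp: directed_def)
    ultimately show "a \<le> y"
      unfolding way_below_def by blast
  qed
  \<comment> \<open>Because \<open>p top = top\<close>, every open of \<open>Y\<close> is a global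
    section, so \<open>y\<close> and \<open>?u\<close> can both enter the internal
    statement.\<close>
  obtain b where b: "b \<in> sec top" "f top b = y"
    by (rule open_surj[of y top]) (simp add: frame_hom_top[OF hom])
  obtain u where u: "u \<in> sec top" "f top u = ?u"
    by (rule open_surj[of ?u top]) (simp add: frame_hom_top[OF hom])
  have "is_join (\<lambda>a. int_way_below a (top, b)) (top, b) top"
    using Y b by (simp add: int_locally_compact_def valid_def fall_def)
  then have least: "((\<^bold>\<forall>s. int_way_below s (top, b) \<^bold>\<longrightarrow> s \<^bold>\<le> (top, u)) \<^bold>\<longrightarrow> (top, b) \<^bold>\<le> (top, u)) top"
    using u(1) unfolding is_join_def fconj_def fall_def by auto
  have "((U, a) \<^bold>\<le> (top, u)) V"
    if a: "a \<in> sec U" and V: "V \<le> U" and ab: "int_way_below (U, a) (top, b) V" for U V a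
  proof -
    \<comment> \<open>Local compactness of \<open>X\<close> splits the restriction of
      \<open>a\<close> to \<open>V\<close> into the pieces \<open>inf (f U a) (p W)\<close> with
      \<open>W \<lless> V\<close>, each of which is way below \<open>y\<close>.\<close>
    have "V = Sup {W. W \<lless> V}"
      using X by (simp add: locally_compact_def)
    then have "inf (f U a) (p V) = Sup (inf (f U a) ` p ` {W. W \<lless> V})"
      by (metis frame_hom_Sup[OF hom] inf_Sup_distrib)
    also have "\<dots> \<le> ?u"
      using way_below_of_int_way_below[OF a b(1) V top_greatest ab] b(2)
      by (intro Sup_subset_mono) auto
    finally show ?thesis
      using a V u by (simp add: fle_iff)
  qed
  then have "((top, b) \<^bold>\<le> (top, u)) top"
    using least by (auto simp: fimp_def fall_def)
  then show "y \<le> ?u"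
    using b u by (simp add: fle_iff frame_hom_top[OF hom])
qed

end

theorem theorem6:
  fixes sec :: "'x::frame \<Rightarrow> 'a set"
    and res :: "'x \<Rightarrow> 'x \<Rightarrow> 'a \<Rightarrow> 'a"
    and le :: "'x \<Rightarrow> 'a \<Rightarrow> 'a \<Rightarrow> bool"
    and p :: "'x \<Rightarrow> 'y::frame"
  assumes "locally_compact TYPE('x)"
    and "internal_frame sec res le"
    and "internal_poset.int_locally_compact sec res le"
    and "external_description sec res le p"
  shows "locally_compact TYPE('y)"
proof -
  obtain f where "frame_hom p"
    and "internal_poset_iso sec res le (push_sec p) (push_res p) push_le f"
    using assms(4) by (auto simp: external_description_def)
  then interpret described_poset sec res le p f
    using assms(2)
    by (auto simp: described_poset_def described_poset_axioms_def internal_frame_def)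
  show ?thesis
    using locally_compact_described assms(1,3) .
qed

end
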